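(* Let $f,g:[-1,1]\to\mathbb{R}$ be continuous functions, neither identically zero, which are the isotropic parts of positive definite kernels on $P^\infty$. The following assertions are equivalent: (i) $fg$ is the isotropic part of a strictly positive definite kernel on $P^\infty$; (ii) at least one of $f$ and $g$ is the isotropic part of a strictly positive definite kernel on $P^\infty$; (iii) at least one of $f$ and $g$ is not a polynomial.
   Context: Let $\mathbb{P}^d(\mathbb{R})$ ($d=2,3,\dots$), $\mathbb{P}^d(\mathbb{C})$ ($d=4,6,\dots$) and $\mathbb{P}^d(\mathbb{H})$ ($d=8,12,\dots$) be the real, complex and quaternionic projective spaces of real dimension $d$, each with its usual Riemannian (geodesic) distance $|xy|$ normalized so that the largest distance equals $2\pi$. On such a space $\mathbb{M}$, a continuous function $f:[-1,1]\to\mathbb{R}$ is called the isotropic part of the kernel $K(x,y)=f(\cos(|xy|/2))$, $x,y\in\mathbb{M}$. The kernel $K$ is positive definite if $\sum_{i,j=1}^n c_ic_jK(x_i,x_j)\ge 0$ for all $n\ge1$, all distinct $x_1,\dots,x_n\in\mathbb{M}$ and all real $c_1,\dots,c_n$; it is strictly positive definite if in addition the inequality is strict whenever $c_1,\dots,c_n$ are not all zero. The phrase "$f$ is the isotropic part of a positive definite kernel on $P^\infty$" means that $f$ is continuous and has a representation $$f(t)=\sum_{k=0}^\infty a_k(f)\left(\frac{1+t}{2}\right)^k,\qquad t\in[-1,1],$$ with all $a_k(f)\ge0$ and the series convergent at $t=1$. It is known that this holds if and only if $f$ is the isotropic part of a positive definite kernel on $\mathbb{P}^d(\mathbb{R})$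 for all admissible $d$; equivalently on $\mathbb{P}^d(\mathbb{C})$ for all admissible $d$; equivalently on $\mathbb{P}^d(\mathbb{H})$ for all admissible $d$. Correspondingly, "$f$ is the isotropic part of a strictly positive definite kernel on $P^\infty$" means that $f$ is the isotropic part of a strictly positive definite kernel on $\mathbb{P}^d(\mathbb{R})$, on $\mathbb{P}^d(\mathbb{C})$ and on $\mathbb{P}^d(\mathbb{H})$, for all admissible $d$ in each case. *)

theory Defs
  imports "HOL-Analysis.Analysis" "HOL-Computational_Algebra.Polynomial"
begin

section \<open>Quaternions\<close>

text \<open>Hamilton's quaternions \<open>a + b i + c j + d k\<close> as a normed division algebra over the reals,
  so that the projective spaces over the reals, the complex numbers and the quaternions can be
  treated by one polymorphic definition.\<close>

datatype quat = Quat (Re4: real) (Im4i: real) (Im4j: real) (Im4k: real)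

lemma quat_eq_iff:
  "x = y \<longleftrightarrow> Re4 x = Re4 y \<and> Im4i x = Im4i y \<and> Im4j x = Im4j y \<and> Im4k x = Im4k y"
  by (cases x; cases y) simp

instantiation quat :: real_vector
begin

definition zero_quat :: quat where "0 = Quat 0 0 0 0"

definition plus_quat :: "quat \<Rightarrow> quat \<Rightarrow> quat" where
  "x + y = Quat (Re4 x + Re4 y) (Im4i x + Im4i y) (Im4j x + Im4j y) (Im4k x + Im4k y)"

definition uminus_quat :: "quat \<Rightarrow> quat" where
  "- x = Quat (- Re4 x) (- Im4i x) (- Im4j x) (- Im4k x)"

definition minus_quat :: "quat \<Rightarrow> quat \<Rightarrow> quat" where
  "x - y = Quat (Re4 x - Re4 y) (Im4i x - Im4i y) (Im4j x - Im4j y) (Im4k x - Im4k y)"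

definition scaleR_quat :: "real \<Rightarrow> quat \<Rightarrow> quat" where
  "scaleR r x = Quat (r * Re4 x) (r * Im4i x) (r * Im4j x) (r * Im4k x)"

instance
proof
  fix x y z :: quat and r s :: real
  show "x + y + z = x + (y + z)" "x + y = y + x" "0 + x = x" "- x + x = 0" "x - y = x + - y"
    by (simp_all add: quat_eq_iff plus_quat_def zero_quat_def uminus_quat_def minus_quat_def)
  show "r *\<^sub>R (x + y) = r *\<^sub>R x + r *\<^sub>R y" "(r + s) *\<^sub>R x = r *\<^sub>R x + s *\<^sub>R x"
    "r *\<^sub>R s *\<^sub>R x = (r * s) *\<^sub>R x" "1 *\<^sub>R x = x"
    by (simp_all add: quat_eq_iff plus_quat_def scaleR_quat_def algebra_simps)
qed

end

instantiation quat :: real_inner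
begin

definition inner_quat :: "quat \<Rightarrow> quat \<Rightarrow> real" where
  "inner x y = Re4 x * Re4 y + Im4i x * Im4i y + Im4j x * Im4j y + Im4k x * Im4k y"

definition norm_quat :: "quat \<Rightarrow> real" where
  "norm x = sqrt ((Re4 x)\<^sup>2 + (Im4i x)\<^sup>2 + (Im4j x)\<^sup>2 + (Im4k x)\<^sup>2)"

definition sgn_quat :: "quat \<Rightarrow> quat" where "sgn x = x /\<^sub>R norm x" for x :: quat

definition dist_quat :: "quat \<Rightarrow> quat \<Rightarrow> real" where "dist x y = norm (x - y)" for x y :: quat

definition uniformity_quat :: "(quat \<times> quat) filter" where
  "uniformity = (INF e\<in>{0<..}. principal {(x :: quat, y). dist x y < e})"

definition open_quat :: "quat set \<Rightarrow> bool" where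
  "open U \<longleftrightarrow> (\<forall>x\<in>U. eventually (\<lambda>(x', y). x' = x \<longrightarrow> y \<in> U) uniformity)" for U :: "quat set"

instance
proof
  fix x y z :: quat and r s :: real and U :: "quat set"
  show "sgn x = x /\<^sub>R norm x" by (simp add: sgn_quat_def)
  show "dist x y = norm (x - y)" by (simp add: dist_quat_def)
  show "uniformity = (INF e\<in>{0<..}. principal {(x, y :: quat). dist x y < e})"
    by (simp add: uniformity_quat_def)
  show "open U \<longleftrightarrow> (\<forall>x\<in>U. eventually (\<lambda>(x', y). x' = x \<longrightarrow> y \<in> U) uniformity)"
    by (simp add: open_quat_def)
  show "inner x y = inner y x" "inner (x + y) z = inner x z + inner y z"
    "inner (r *\<^sub>R x) y = r * inner x y"
    by (simp_all add: inner_quat_def plus_quat_def scaleR_quat_def algebra_simps)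
  show "0 \<le> inner x x" by (simp add: inner_quat_def)
  show "inner x x = 0 \<longleftrightarrow> x = 0"
    by (simp add: inner_quat_def quat_eq_iff zero_quat_def add_nonneg_eq_0_iff conj_assoc)
  show "norm x = sqrt (inner x x)"
    by (simp add: norm_quat_def inner_quat_def power2_eq_square)
qed

end

instantiation quat :: real_normed_div_algebra
begin

definition one_quat :: quat where "1 = Quat 1 0 0 0"

definition times_quat :: "quat \<Rightarrow> quat \<Rightarrow> quat" where
  "x * y = Quat
    (Re4 x * Re4 y - Im4i x * Im4i y - Im4j x * Im4j y - Im4k x * Im4k y)
    (Re4 x * Im4i y + Im4i x * Re4 y + Im4j x * Im4k y - Im4k x * Im4j y)
    (Re4 x * Im4j y - Im4i x * Im4k y + Im4j x * Re4 y + Im4k x * Im4i y)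
    (Re4 x * Im4k y + Im4i x * Im4j y - Im4j x * Im4i y + Im4k x * Re4 y)"

definition inverse_quat :: "quat \<Rightarrow> quat" where
  "inverse x = Quat (Re4 x) (- Im4i x) (- Im4j x) (- Im4k x) /\<^sub>R (norm x)\<^sup>2"

definition divide_quat :: "quat \<Rightarrow> quat \<Rightarrow> quat" where
  "x div y = x * inverse y" for x y :: quat

instance
proof
  fix x y z :: quat and r s :: real
  have n2: "(norm x)\<^sup>2 = (Re4 x)\<^sup>2 + (Im4i x)\<^sup>2 + (Im4j x)\<^sup>2 + (Im4k x)\<^sup>2" for x :: quat
    by (simp add: norm_quat_def)
  show "x * y * z = x * (y * z)"
    by (simp add: quat_eq_iff times_quat_def algebra_simps)
  show "1 * x = x" "x * 1 = x" by (simp_all add: quat_eq_iff times_quat_def one_quat_def)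
  show "(x + y) * z = x * z + y * z" "x * (y + z) = x * y + x * z"
    by (simp_all add: quat_eq_iff times_quat_def plus_quat_def algebra_simps)
  show "(0::quat) \<noteq> 1" by (simp add: zero_quat_def one_quat_def)
  show scale: "r *\<^sub>R x * y = r *\<^sub>R (x * y)" "x * r *\<^sub>R y = r *\<^sub>R (x * y)" for r and x y :: quat
    by (simp_all add: quat_eq_iff times_quat_def scaleR_quat_def algebra_simps)
  show "inverse x * x = 1" "x * inverse x = 1" if "x \<noteq> 0"
  proof -
    let ?c = "Quat (Re4 x) (- Im4i x) (- Im4j x) (- Im4k x)"
    have n2': "norm x * norm x = Re4 x * Re4 x + Im4i x * Im4i x + Im4j x * Im4j x + Im4k x * Im4k x"
      using n2[of x] by (simp only: power2_eq_square)
    have c: "?c * x = (norm x)\<^sup>2 *\<^sub>R 1" "x * ?c = (norm x)\<^sup>2 *\<^sub>R 1"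
      unfolding power2_eq_square n2'
      by (simp_all add: quat_eq_iff times_quat_def scaleR_quat_def one_quat_def)
    have "(norm x)\<^sup>2 \<noteq> 0" using that by simp
    from left_inverse[OF this] have "inverse ((norm x)\<^sup>2) *\<^sub>R (norm x)\<^sup>2 *\<^sub>R (1::quat) = 1"
      by (simp only: scaleR_scaleR scaleR_one)
    then show "inverse x * x = 1" "x * inverse x = 1"
      by (simp_all only: inverse_quat_def scale c)
  qed
  show "inverse (0::quat) = 0"
    by (simp add: quat_eq_iff inverse_quat_def scaleR_quat_def zero_quat_def)
  show "x div y = x * inverse y" by (simp add: divide_quat_def)
  have "(norm (x * y))\<^sup>2 = (norm x * norm y)\<^sup>2"
    unfolding power_mult_distrib n2 by (simp add: times_quat_def) algebra
  then show "norm (x * y) = norm x * norm y"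
    by (simp add: power2_eq_iff_nonneg)
qed

end

section \<open>Projective spaces\<close>

text \<open>Vectors of \<open>K\<^sup>n\<^sup>+\<^sup>1\<close> are functions \<open>v :: nat \<Rightarrow> 'a\<close> vanishing above \<open>n\<close>; scalars act from the
  right, coordinatewise.  The points of \<open>P\<^sup>n(K)\<close> are the one-dimensional subspaces.  Its real
  dimension is \<open>d = n\<close>, \<open>d = 2 n\<close>, \<open>d = 4 n\<close> for the reals, complex numbers and quaternions.\<close>

definition proj_vectors :: "nat \<Rightarrow> (nat \<Rightarrow> 'a::zero) set" where
  "proj_vectors n = {v. \<forall>i>n. v i = 0}"

definition proj_line :: "(nat \<Rightarrow> 'a::times) \<Rightarrow> (nat \<Rightarrow> 'a) set" where
  "proj_line v = range (\<lambda>c i. v i * c)"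

definition proj_space :: "nat \<Rightarrow> (nat \<Rightarrow> 'a::{real_normed_div_algebra,real_inner}) set set" where
  "proj_space n = proj_line ` {v \<in> proj_vectors n. v \<noteq> (\<lambda>_. 0)}"

definition proj_inner ::
  "nat \<Rightarrow> (nat \<Rightarrow> 'a::{real_normed_div_algebra,real_inner}) \<Rightarrow> (nat \<Rightarrow> 'a) \<Rightarrow> real" where
  "proj_inner n u v = (\<Sum>i\<le>n. inner (u i) (v i))"

text \<open>The Riemannian metric of \<open>P\<^sup>n(K)\<close> is the quotient of the round metric under the Hopf fibration
  \<open>S(K\<^sup>n\<^sup>+\<^sup>1) \<rightarrow> P\<^sup>n(K)\<close>, whose fibres are the sets of unit vectors of the lines.  The geodesic distance of
  two points is therefore the least spherical distance (angle) between unit vectors of the two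
  lines.  Its largest value is \<open>\<pi>/2\<close>, hence the factor 4 (see \<open>proj_dist_le\<close>, \<open>proj_dist_attained\<close>).\<close>

definition proj_dist ::
  "nat \<Rightarrow> (nat \<Rightarrow> 'a::{real_normed_div_algebra,real_inner}) set \<Rightarrow> (nat \<Rightarrow> 'a) set \<Rightarrow> real" where
  "proj_dist n L M = 4 * Inf {arccos (proj_inner n u v) | u v.
     u \<in> L \<and> v \<in> M \<and> proj_inner n u u = 1 \<and> proj_inner n v v = 1}"

lemma proj_space_unit_vector:
  assumes "L \<in> proj_space n"
  obtains u where "u \<in> L" "proj_inner n u u = 1" "(\<lambda>i. - u i) \<in> L"
proof -
  obtain w where w: "w \<in> proj_vectors n" "w \<noteq> (\<lambda>_. 0)" "L = proj_line w"
    using assms by (auto simp: proj_space_def)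
  define s where "s = sqrt (proj_inner n w w)"
  from w obtain j where j: "j \<le> n" "w j \<noteq> 0"
    by (auto simp: proj_vectors_def fun_eq_iff) (meson not_le)
  then have "0 < inner (w j) (w j)" by simp
  also have "\<dots> \<le> proj_inner n w w"
    unfolding proj_inner_def by (rule member_le_sum) (use j in auto)
  finally have s: "s > 0" "s * s = proj_inner n w w" by (auto simp: s_def)
  define u where "u = (\<lambda>i. w i * of_real (inverse s))"
  show thesis
  proof
    show "u \<in> L" by (auto simp: w u_def proj_line_def)
    have "(\<lambda>i. - u i) = (\<lambda>i. w i * (- of_real (inverse s)))" by (simp add: u_def)
    then show "(\<lambda>i. - u i) \<in> L" unfolding w(3) proj_line_def by (rule range_eqI)
    have "u i = inverse s *\<^sub>R w i" for i
      by (simp only: u_def Real_Vector_Spaces.of_real_def mult_scaleR_right mult_1_right)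
    then have "proj_inner n u u = inverse s * (inverse s * proj_inner n w w)"
      by (simp add: proj_inner_def sum_distrib_left)
    then show "proj_inner n u u = 1" unfolding s(2)[symmetric] using s(1) by (simp add: field_simps)
  qed
qed

lemma proj_inner_abs_le:
  assumes "proj_inner n u u = 1" "proj_inner n v v = 1"
  shows "\<bar>proj_inner n u v\<bar> \<le> 1"
proof -
  have "0 \<le> proj_inner n (\<lambda>i. u i - v i) (\<lambda>i. u i - v i)"
    "0 \<le> proj_inner n (\<lambda>i. u i + v i) (\<lambda>i. u i + v i)"
    by (auto simp: proj_inner_def intro: sum_nonneg)
  moreover have
    "proj_inner n (\<lambda>i. u i - v i) (\<lambda>i. u i - v i) = 2 - 2 * proj_inner n u v"
    "proj_inner n (\<lambda>i. u i + v i) (\<lambda>i. u i + v i) = 2 + 2 * proj_inner n u v"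
    using assms unfolding proj_inner_def
    by (simp_all add: inner_diff inner_add sum.distrib sum_subtractf inner_commute sum_distrib_left)
  ultimately show ?thesis by linarith
qed

lemma proj_dist_le:
  fixes L M :: "(nat \<Rightarrow> 'a::{real_normed_div_algebra,real_inner}) set"
  assumes "L \<in> proj_space n" "M \<in> proj_space n"
  shows "proj_dist n L M \<le> 2 * pi"
proof -
  obtain u where u: "u \<in> L" "proj_inner n u u = 1" "(\<lambda>i. - u i) \<in> L"
    using assms(1) by (rule proj_space_unit_vector)
  obtain v where v: "v \<in> M" "proj_inner n v v = 1"
    using assms(2) by (rule proj_space_unit_vector)
  have neg: "proj_inner n (\<lambda>i. - u i) v = - proj_inner n u v"
    "proj_inner n (\<lambda>i. - u i) (\<lambda>i. - u i) = 1"
    using u by (simp_all add: proj_inner_def sum_negf)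
  obtain u' where u': "u' \<in> L" "proj_inner n u' u' = 1" "proj_inner n u' v \<ge> 0"
    using u neg by (cases "proj_inner n u v \<ge> 0") auto
  let ?S = "{arccos (proj_inner n u v) | u v.
     u \<in> L \<and> v \<in> M \<and> proj_inner n u u = 1 \<and> proj_inner n v v = 1}"
  have "bdd_below ?S"
    by (rule bdd_belowI[of _ 0]) (use proj_inner_abs_le in \<open>force intro!: arccos_lbound\<close>)
  then have "Inf ?S \<le> arccos (proj_inner n u' v)"
    by (rule cInf_lower[rotated]) (use u' v in blast)
  also have "\<dots> \<le> pi / 2"
    using u' v proj_inner_abs_le[of n u' v] by (intro arccos_le_pi2) auto
  finally show ?thesis by (simp add: proj_dist_def)
qed

lemma proj_dist_attained:
  assumes "n \<ge> 1"
  shows "\<exists>L \<in> proj_space n. \<exists>M \<in> proj_space n.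
    proj_dist n L (M :: (nat \<Rightarrow> 'a::{real_normed_div_algebra,real_inner}) set) = 2 * pi"
proof -
  define e :: "nat \<Rightarrow> nat \<Rightarrow> 'a" where "e = (\<lambda>k i. if i = k then 1 else 0)"
  have P: "proj_line (e k) \<in> proj_space n" if "k \<le> n" for k
    using that unfolding proj_space_def
    by (intro imageI) (auto simp: e_def proj_vectors_def fun_eq_iff)
  have 0: "proj_inner n u v = 0" if "u \<in> proj_line (e 0)" "v \<in> proj_line (e 1)" for u v
    using that by (auto simp: proj_line_def proj_inner_def e_def intro!: sum.neutral)
  obtain u where u: "u \<in> proj_line (e 0)" "proj_inner n u u = 1"
    using proj_space_unit_vector[OF P[of 0]] by blast
  obtain v where v: "v \<in> proj_line (e 1)" "proj_inner n v v = 1"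
    using proj_space_unit_vector[OF P[of 1]] assms by blast
  have "{arccos (proj_inner n u v) | u v. u \<in> proj_line (e 0) \<and> v \<in> proj_line (e 1) \<and>
      proj_inner n u u = 1 \<and> proj_inner n v v = 1} = {pi / 2}"
  proof (intro equalityI subsetI)
    fix x assume "x \<in> {pi / 2}"
    then have "x = arccos (proj_inner n u v)" using 0 u v by simp
    then show "x \<in> {arccos (proj_inner n u v) | u v. u \<in> proj_line (e 0) \<and> v \<in> proj_line (e 1) \<and>
      proj_inner n u u = 1 \<and> proj_inner n v v = 1}" using u v by blast
  qed (auto simp: 0)
  then have "proj_dist n (proj_line (e 0)) (proj_line (e 1)) = 2 * pi"
    by (simp add: proj_dist_def)
  with P[of 0] P[of 1] assms show ?thesis by auto
qed

section \<open>Positive definite kernels and isotropic parts\<close>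

definition positive_definite_kernel :: "'p set \<Rightarrow> ('p \<Rightarrow> 'p \<Rightarrow> real) \<Rightarrow> bool" where
  "positive_definite_kernel M K \<longleftrightarrow>
     (\<forall>n\<ge>1. \<forall>x :: nat \<Rightarrow> 'p. \<forall>c :: nat \<Rightarrow> real.
        x ` {1..n} \<subseteq> M \<and> inj_on x {1..n} \<longrightarrow>
        (\<Sum>i=1..n. \<Sum>j=1..n. c i * c j * K (x i) (x j)) \<ge> 0)"

definition strictly_positive_definite_kernel :: "'p set \<Rightarrow> ('p \<Rightarrow> 'p \<Rightarrow> real) \<Rightarrow> bool" where
  "strictly_positive_definite_kernel M K \<longleftrightarrow>
     positive_definite_kernel M K \<and>
     (\<forall>n\<ge>1. \<forall>x :: nat \<Rightarrow> 'p. \<forall>c :: nat \<Rightarrow> real.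
        x ` {1..n} \<subseteq> M \<and> inj_on x {1..n} \<and> (\<exists>i\<in>{1..n}. c i \<noteq> 0) \<longrightarrow>
        (\<Sum>i=1..n. \<Sum>j=1..n. c i * c j * K (x i) (x j)) > 0)"

definition isotropic_kernel :: "nat \<Rightarrow> (real \<Rightarrow> real) \<Rightarrow>
    (nat \<Rightarrow> 'a::{real_normed_div_algebra,real_inner}) set \<Rightarrow> (nat \<Rightarrow> 'a) set \<Rightarrow> real" where
  "isotropic_kernel n f = (\<lambda>x y. f (cos (proj_dist n x y / 2)))"

text \<open>Functions on \<open>[-1,1]\<close> are total functions on the reals whose values outside \<open>[-1,1]\<close> are
  irrelevant.\<close>

definition pd_P_infinity :: "(real \<Rightarrow> real) \<Rightarrow> bool" where
  "pd_P_infinity f \<longleftrightarrow> continuous_on {-1..1} f \<and>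
     (\<exists>a :: nat \<Rightarrow> real. (\<forall>k. a k \<ge> 0) \<and>
        (\<forall>t\<in>{-1..1}. (\<lambda>k. a k * ((1 + t) / 2) ^ k) sums f t))"

definition spd_P_infinity :: "(real \<Rightarrow> real) \<Rightarrow> bool" where
  "spd_P_infinity f \<longleftrightarrow> continuous_on {-1..1} f \<and>
     (\<forall>d\<ge>2. strictly_positive_definite_kernel
        (proj_space d :: (nat \<Rightarrow> real) set set) (isotropic_kernel d f)) \<and>
     (\<forall>d\<ge>4. 2 dvd d \<longrightarrow> strictly_positive_definite_kernel
        (proj_space (d div 2) :: (nat \<Rightarrow> complex) set set) (isotropic_kernel (d div 2) f)) \<and>
     (\<forall>d\<ge>8. 4 dvd d \<longrightarrow> strictly_positive_definite_kernel
        (proj_space (d div 4) :: (nat \<Rightarrow> quat) set set) (isotropic_kernel (d div 4) f))"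

definition polynomial_on_Icc :: "(real \<Rightarrow> real) \<Rightarrow> bool" where
  "polynomial_on_Icc f \<longleftrightarrow> (\<exists>p :: real poly. \<forall>t\<in>{-1..1}. f t = poly p t)"

end

theory Submission
  imports Defs
begin

text \<open>If \<open>u\<close> and \<open>v\<close> are unit vectors spanning two points of a projective space, then
  \<open>(1 + cos (dist / 2)) / 2 = |\<langle>u, v\<rangle>|\<^sup>2\<close>, so the kernel with isotropic part
  \<open>f t = (\<Sum>k. a\<^sub>k ((1 + t) / 2)\<^sup>k)\<close> is \<open>\<Sum>k. a\<^sub>k |\<langle>u, v\<rangle>|\<^sup>2\<^sup>k\<close>.  Each \<open>|\<langle>u, v\<rangle>|\<^sup>2\<^sup>k\<close> is positive
  definite, and for distinct points its Gram matrices tend to the identity as \<open>k \<rightarrow> \<infinity>\<close>.  Hence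
  infinitely many positive \<open>a\<^sub>k\<close> force strict positive definiteness on every space.  Conversely, if
  \<open>f\<close> is a polynomial, then restricted to a projective line of \<open>P\<^sup>2(\<real>)\<close> the kernel has finite rank,
  so it is not strictly positive definite.  The coefficients of \<open>f g\<close> are the Cauchy product of
  those of \<open>f\<close> and \<open>g\<close>, so infinitely many of them are positive as soon as one of the factors has
  infinitely many and the other at least one.\<close>

section \<open>Conjugation in a normed division algebra with inner product\<close>

text \<open>Supplies the finite orthonormal basis in which \<open>hermitian_power_nonneg\<close>
  expands inner products. The reals and complex numbers already have one.\<close>

instantiation quat :: euclidean_space
begin

definition Basis_quat :: "quat set" where
  "Basis = {Quat 1 0 0 0, Quat 0 1 0 0, Quat 0 0 1 0, Quat 0 0 0 1}"

instance
proof
  fix u v x :: quat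
  show "(Basis :: quat set) \<noteq> {}" "finite (Basis :: quat set)"
    by (simp_all add: Basis_quat_def)
  show "inner u v = (if u = v then 1 else 0)" if "u \<in> Basis" "v \<in> Basis"
    using that unfolding Basis_quat_def by (elim insertE emptyE) (simp_all add: inner_quat_def)
  show "(\<forall>u\<in>Basis. inner x u = 0) \<longleftrightarrow> x = 0"
    unfolding Basis_quat_def ball_simps
    by (simp add: inner_quat_def quat_eq_iff[of x] zero_quat_def)
qed

end

text \<open>Since \<open>inner x 1\<close> is the real part of \<open>x\<close>, this is the usual
  conjugation, written without components so that it serves all three algebras at once.\<close>

definition conjugate :: "'a::{real_normed_div_algebra,real_inner} \<Rightarrow> 'a" where
  "conjugate x = (2 * inner x 1) *\<^sub>R 1 - x"

lemma inner_one_one: "inner (1::'a::{real_normed_div_algebra,real_inner}) 1 = 1"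
  by (simp add: power2_norm_eq_inner[symmetric])

lemma conjugate_conjugate [simp]: "conjugate (conjugate x) = x"
  by (simp add: conjugate_def inner_diff_left inner_one_one)

text \<open>Polarization of the multiplicativity of the norm.\<close>

lemma inner_mult_mult_left:
  fixes x y z :: "'a::{real_normed_div_algebra,real_inner}"
  shows "inner (x * y) (x * z) = inner x x * inner y z"
proof -
  have N: "inner (x * w) (x * w) = inner x x * inner w w" for w :: 'a
    by (simp add: power2_norm_eq_inner[symmetric] norm_mult power_mult_distrib)
  show ?thesis
    using N[of "y + z"] N[of y] N[of z]
    by (simp add: distrib_left inner_add_left inner_add_right inner_commute)
qed

lemma inner_mult_mult_right:
  fixes x y z :: "'a::{real_normed_div_algebra,real_inner}"
  shows "inner (y * x) (z * x) = inner x x * inner y z"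
proof -
  have N: "inner (w * x) (w * x) = inner x x * inner w w" for w :: 'a
    by (simp add: power2_norm_eq_inner[symmetric] norm_mult power_mult_distrib)
  show ?thesis
    using N[of "y + z"] N[of y] N[of z]
    by (simp add: distrib_right distrib_left inner_add_left inner_add_right inner_commute)
qed

text \<open>Polarizing once more, in the multiplier \<open>x\<close> against \<open>1\<close>, shows
  that left multiplication by \<open>x\<close> plus its adjoint is the scalar
  \<open>2 * inner x 1\<close>.\<close>

lemma inner_mult_left_adjoint:
  fixes x y z :: "'a::{real_normed_div_algebra,real_inner}"
  shows "inner (x * y) z = inner y (conjugate x * z)"
proof -
  have "inner ((x + 1) * y) ((x + 1) * z) = inner (x + 1) (x + 1) * inner y z"
    by (rule inner_mult_mult_left)
  then have "inner (x * y) z + inner y (x * z) = 2 * inner x 1 * inner y z"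
    using inner_mult_mult_left[of x y z]
    by (simp add: distrib_right inner_add_left inner_add_right inner_one_one
        inner_commute[of 1 x])
  then show ?thesis
    by (simp add: conjugate_def left_diff_distrib inner_diff_right)
qed

lemma inner_mult_right_adjoint:
  fixes x y z :: "'a::{real_normed_div_algebra,real_inner}"
  shows "inner (y * x) z = inner y (z * conjugate x)"
proof -
  have "inner (y * (x + 1)) (z * (x + 1)) = inner (x + 1) (x + 1) * inner y z"
    by (rule inner_mult_mult_right)
  then have "inner (y * x) z + inner y (z * x) = 2 * inner x 1 * inner y z"
    using inner_mult_mult_right[of y x z]
    by (simp add: distrib_right distrib_left inner_add_left inner_add_right inner_one_one
        inner_commute[of 1 x])
  then show ?thesis
    by (simp add: conjugate_def right_diff_distrib inner_diff_right)
qed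

section \<open>The kernel in terms of the Hermitian product\<close>

text \<open>The conjugate sits on the left factor because scalars act from the right:
  \<open>hermitian n u v\<close> then becomes \<open>hermitian n u v * c\<close> when
  \<open>v\<close> is scaled by \<open>c\<close>.\<close>

definition hermitian ::
  "nat \<Rightarrow> (nat \<Rightarrow> 'a::{real_normed_div_algebra,real_inner}) \<Rightarrow> (nat \<Rightarrow> 'a) \<Rightarrow> 'a" where
  "hermitian n u v = (\<Sum>i\<le>n. conjugate (u i) * v i)"

text \<open>The right side is the real inner product of the rank-one matrices \<open>u u*\<close>
  and \<open>v v*\<close>. This exhibits the squared modulus as a Gram kernel.\<close>

lemma norm_hermitian_sq:
  "(norm (hermitian n u v))\<^sup>2 =
    (\<Sum>i\<le>n. \<Sum>j\<le>n. inner (u i * conjugate (u j)) (v i * conjugate (v j)))"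
proof -
  have "inner (conjugate (u i) * v i) (conjugate (u j) * v j) =
      inner (u i * conjugate (u j)) (v i * conjugate (v j))" for i j
  proof -
    have "inner (conjugate (u i) * v i) (conjugate (u j) * v j) =
        inner ((u i * conjugate (u j)) * v j) (v i)"
      by (simp add: inner_mult_left_adjoint[of "conjugate (u i)"] inner_commute mult.assoc)
    also have "\<dots> = inner (u i * conjugate (u j)) (v i * conjugate (v j))"
      by (rule inner_mult_right_adjoint)
    finally show ?thesis .
  qed
  then show ?thesis
    by (simp add: power2_norm_eq_inner hermitian_def inner_sum_left inner_sum_right)
      (rule sum.swap)
qed

lemma proj_inner_mult:
  "proj_inner n (\<lambda>i. u i * a) (\<lambda>i. v i * c) = inner a (hermitian n u v * c)"
  by (simp add: proj_inner_def hermitian_def inner_mult_left_adjoint sum_distrib_right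
      inner_sum_right mult.assoc)

lemma proj_inner_mult_self:
  assumes "proj_inner n u u = 1"
  shows "proj_inner n (\<lambda>i. u i * a) (\<lambda>i. u i * a) = (norm a)\<^sup>2"
  using assms
  by (simp add: proj_inner_def inner_mult_mult_right sum_distrib_left[symmetric]
      power2_norm_eq_inner)

text \<open>Equality case of Cauchy-Schwarz: \<open>a\<close> is the direction of the Hermitian
  product, or \<open>1\<close> if that product vanishes.\<close>

lemma hermitian_attained:
  assumes "proj_inner n u u = 1"
  obtains a where "norm a = 1" "proj_inner n (\<lambda>i. u i * a) v = norm (hermitian n u v)"
proof -
  let ?h = "hermitian n u v"
  show thesis
  proof (cases "?h = 0")
    case True
    then show ?thesis
      using that[of 1] proj_inner_mult[of n u 1 v 1] by simp
  next
    case False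
    then have "proj_inner n (\<lambda>i. u i * sgn ?h) v = norm ?h"
      using proj_inner_mult[of n u "sgn ?h" v 1]
      by (simp add: sgn_div_norm dot_square_norm power2_eq_square)
    then show ?thesis
      using that[of "sgn ?h"] False by (simp add: norm_sgn)
  qed
qed

lemma norm_hermitian_le_one:
  assumes u: "proj_inner n u u = 1" and v: "proj_inner n v v = 1"
  shows "norm (hermitian n u v) \<le> 1"
proof -
  obtain a where a: "norm a = 1" "proj_inner n (\<lambda>i. u i * a) v = norm (hermitian n u v)"
    using hermitian_attained[OF u] .
  show ?thesis
    using proj_inner_abs_le[of n "\<lambda>i. u i * a" v] a v proj_inner_mult_self[OF u, of a] by simp
qed

text \<open>Unit vectors of the two lines have inner product at most the modulus of the Hermitian
  product by Cauchy-Schwarz, and a rotated \<open>u\<close> attains it. As \<open>arccos\<close>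
  decreases, the infimum is a minimum.\<close>

lemma proj_dist_hermitian:
  fixes u v :: "nat \<Rightarrow> 'a::{real_normed_div_algebra,real_inner}"
  assumes u: "proj_inner n u u = 1" and v: "proj_inner n v v = 1"
  shows "proj_dist n (proj_line u) (proj_line v) = 4 * arccos (norm (hermitian n u v))"
proof -
  let ?h = "hermitian n u v"
  have "Inf {arccos (proj_inner n x y) | x y. x \<in> proj_line u \<and> y \<in> proj_line v \<and>
      proj_inner n x x = 1 \<and> proj_inner n y y = 1} = arccos (norm ?h)"
  proof (rule cInf_eq_minimum)
    obtain a where a: "norm a = 1" "proj_inner n (\<lambda>i. u i * a) v = norm ?h"
      using hermitian_attained[OF u] .
    have "v \<in> proj_line v" "(\<lambda>i. u i * a) \<in> proj_line u"
      unfolding proj_line_def by (auto intro!: range_eqI[of _ _ 1])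
    then show "arccos (norm ?h) \<in> {arccos (proj_inner n x y) | x y. x \<in> proj_line u \<and>
        y \<in> proj_line v \<and> proj_inner n x x = 1 \<and> proj_inner n y y = 1}"
      using a v proj_inner_mult_self[OF u, of a]
      by (intro CollectI exI[of _ "\<lambda>i. u i * a"] exI[of _ v]) simp
  next
    fix r
    assume "r \<in> {arccos (proj_inner n x y) | x y. x \<in> proj_line u \<and>
        y \<in> proj_line v \<and> proj_inner n x x = 1 \<and> proj_inner n y y = 1}"
    then obtain a c where r: "r = arccos (proj_inner n (\<lambda>i. u i * a) (\<lambda>i. v i * c))"
      and ac: "proj_inner n (\<lambda>i. u i * a) (\<lambda>i. u i * a) = 1"
        "proj_inner n (\<lambda>i. v i * c) (\<lambda>i. v i * c) = 1"
      by (auto simp: proj_line_def)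
    then have n: "norm a = 1" "norm c = 1"
      by (simp_all add: proj_inner_mult_self u v power2_eq_1_iff)
         (smt (verit) norm_ge_zero)+
    have "inner a (?h * c) \<le> norm a * norm (?h * c)"
      by (rule norm_cauchy_schwarz)
    then have "proj_inner n (\<lambda>i. u i * a) (\<lambda>i. v i * c) \<le> norm ?h"
      using n by (simp add: proj_inner_mult norm_mult)
    then show "arccos (norm ?h) \<le> r"
      unfolding r using proj_inner_abs_le[OF ac] norm_hermitian_le_one[OF u v]
      by (intro arccos_le_arccos) auto
  qed
  then show ?thesis by (simp add: proj_dist_def)
qed

text \<open>Half the distance is twice an \<open>arccos\<close>, so the double angle formula
  applies.\<close>

lemma isotropic_kernel_hermitian:
  assumes u: "proj_inner n u u = 1" and v: "proj_inner n v v = 1"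
  shows "isotropic_kernel n f (proj_line u) (proj_line v) =
    f (2 * (norm (hermitian n u v))\<^sup>2 - 1)"
proof -
  have "\<bar>norm (hermitian n u v)\<bar> \<le> 1" using norm_hermitian_le_one[OF u v] by simp
  then show ?thesis
    by (simp add: isotropic_kernel_def proj_dist_hermitian[OF u v] cos_double_cos cos_arccos_abs)
qed

lemma proj_space_unit_span:
  fixes L :: "(nat \<Rightarrow> 'a::{real_normed_div_algebra,real_inner}) set"
  assumes "L \<in> proj_space n"
  obtains u where "L = proj_line u" "proj_inner n u u = 1" "u \<in> proj_vectors n"
proof -
  obtain w where w: "w \<in> proj_vectors n" "L = proj_line w"
    using assms by (auto simp: proj_space_def)
  obtain u where u: "u \<in> L" "proj_inner n u u = 1"
    using assms by (rule proj_space_unit_vector)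
  obtain c where c: "u = (\<lambda>i. w i * c)" using u w by (auto simp: proj_line_def)
  have "c \<noteq> 0" using u(2) by (auto simp: c proj_inner_def)
  have "proj_line w = proj_line u"
  proof (intro equalityI subsetI)
    fix x assume "x \<in> proj_line w"
    then obtain b where "x = (\<lambda>i. w i * b)" by (auto simp: proj_line_def)
    then have "x = (\<lambda>i. u i * (inverse c * b))"
      using \<open>c \<noteq> 0\<close> by (simp add: c mult.assoc mult.assoc[of c, symmetric])
    then show "x \<in> proj_line u" by (auto simp: proj_line_def)
  qed (auto simp: proj_line_def c mult.assoc)
  moreover have "u \<in> proj_vectors n" using w by (simp add: c proj_vectors_def)
  ultimately show thesis using that w u by blast
qed

text \<open>If the modulus were 1, a rotated \<open>u\<close> would have inner product 1 with
  \<open>v\<close>, hence distance 0 from it, and the lines would agree.\<close>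

lemma norm_hermitian_less_one:
  fixes u v :: "nat \<Rightarrow> 'a::{real_normed_div_algebra,real_inner}"
  assumes u: "proj_inner n u u = 1" "u \<in> proj_vectors n"
    and v: "proj_inner n v v = 1" "v \<in> proj_vectors n"
    and ne: "proj_line u \<noteq> proj_line v"
  shows "norm (hermitian n u v) < 1"
proof (rule ccontr)
  assume "\<not> norm (hermitian n u v) < 1"
  then have h: "norm (hermitian n u v) = 1"
    using norm_hermitian_le_one[OF u(1) v(1)] by simp
  obtain a where a: "norm a = 1" "proj_inner n (\<lambda>i. u i * a) v = norm (hermitian n u v)"
    using hermitian_attained[OF u(1)] .
  have "proj_inner n (\<lambda>i. u i * a - v i) (\<lambda>i. u i * a - v i) =
      proj_inner n (\<lambda>i. u i * a) (\<lambda>i. u i * a) - 2 * proj_inner n (\<lambda>i. u i * a) v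
        + proj_inner n v v"
    unfolding proj_inner_def
    by (simp add: inner_diff sum.distrib sum_subtractf inner_commute sum_distrib_left)
  also have "\<dots> = 0" using proj_inner_mult_self[OF u(1), of a] a h v by simp
  finally have "\<forall>i\<le>n. u i * a - v i = 0"
    by (auto simp: proj_inner_def sum_nonneg_eq_0_iff)
  \<comment> \<open>\<open>proj_inner n\<close> sees only the coordinates up to \<open>n\<close>;
    the others vanish by \<open>proj_vectors\<close>.\<close>
  moreover have "\<forall>i>n. u i * a - v i = 0" using u v by (simp add: proj_vectors_def)
  ultimately have "v = (\<lambda>i. u i * a)" by (metis eq_iff_diff_eq_0 ext not_le)
  then have "v \<in> proj_line u" by (auto simp: proj_line_def)
  have "a \<noteq> 0" using a by auto
  have "proj_line u = proj_line v"
  proof (intro equalityI subsetI)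
    fix x assume "x \<in> proj_line u"
    then obtain b where "x = (\<lambda>i. u i * b)" by (auto simp: proj_line_def)
    then have "x = (\<lambda>i. v i * (inverse a * b))"
      using \<open>a \<noteq> 0\<close> by (simp add: \<open>v = _\<close> mult.assoc mult.assoc[of a, symmetric])
    then show "x \<in> proj_line v" by (auto simp: proj_line_def)
  qed (auto simp: proj_line_def \<open>v = _\<close> mult.assoc)
  with ne show False by simp
qed

section \<open>Infinitely many positive coefficients\<close>

text \<open>Replacing \<open>c\<close> by \<open>c \<cdot> \<phi> m\<close> absorbs one factor of the Gram matrix; this is the Schur product
  theorem for Gram matrices.\<close>

lemma gram_power_nonneg:
  fixes \<phi> :: "'m \<Rightarrow> 'p \<Rightarrow> real" and c :: "'p \<Rightarrow> real"
  assumes K: "\<And>p q. K p q = (\<Sum>m\<in>I. \<phi> m p * \<phi> m q)"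
  shows "(\<Sum>p\<in>A. \<Sum>q\<in>A. c p * c q * K p q ^ k) \<ge> 0"
proof (induction k arbitrary: c)
  case 0
  have "(\<Sum>p\<in>A. \<Sum>q\<in>A. c p * c q) = (\<Sum>p\<in>A. c p) * (\<Sum>q\<in>A. c q)"
    by (simp add: sum_product)
  then show ?case by simp
next
  case (Suc k)
  have "(\<Sum>p\<in>A. \<Sum>q\<in>A. c p * c q * K p q ^ Suc k) =
      (\<Sum>p\<in>A. \<Sum>q\<in>A. \<Sum>m\<in>I. (c p * \<phi> m p) * (c q * \<phi> m q) * K p q ^ k)"
    by (simp add: K[of p q for p q] sum_distrib_left sum_distrib_right mult_ac)
  also have "\<dots> = (\<Sum>m\<in>I. \<Sum>p\<in>A. \<Sum>q\<in>A. (c p * \<phi> m p) * (c q * \<phi> m q) * K p q ^ k)"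
    by (simp only: sum.swap[of _ I A])
  also have "\<dots> \<ge> 0" by (intro sum_nonneg Suc.IH)
  finally show ?case .
qed

lemma hermitian_power_nonneg:
  fixes u :: "'p \<Rightarrow> nat \<Rightarrow> 'a::{real_normed_div_algebra,euclidean_space}" and c :: "'p \<Rightarrow> real"
  shows "(\<Sum>p\<in>A. \<Sum>q\<in>A. c p * c q * (norm (hermitian n (u p) (u q)))\<^sup>2 ^ k) \<ge> 0"
proof -
  \<comment> \<open>The features are the real coordinates of the entries of the rank-one matrix
    \<open>u u*\<close>.\<close>
  define \<phi> where "\<phi> = (\<lambda>(i, j, b :: 'a) p. inner (u p i * conjugate (u p j)) b)"
  have "(norm (hermitian n (u p) (u q)))\<^sup>2 =
      (\<Sum>m\<in>{..n} \<times> {..n} \<times> Basis. \<phi> m p * \<phi> m q)" for p q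
    by (simp add: norm_hermitian_sq sum.cartesian_product case_prod_unfold \<phi>_def
        euclidean_inner[of "_ * _" "_ * _"])
  then show ?thesis by (rule gram_power_nonneg)
qed

lemma gram_power_tendsto:
  fixes K :: "'p \<Rightarrow> 'p \<Rightarrow> real"
  assumes "finite A" and one: "\<And>p. p \<in> A \<Longrightarrow> K p p = 1"
    and less: "\<And>p q. p \<in> A \<Longrightarrow> q \<in> A \<Longrightarrow> p \<noteq> q \<Longrightarrow> \<bar>K p q\<bar> < 1"
  shows "(\<lambda>k. \<Sum>p\<in>A. \<Sum>q\<in>A. c p * c q * K p q ^ k) \<longlonglongrightarrow> (\<Sum>p\<in>A. (c p)\<^sup>2)"
proof -
  have "(\<lambda>k. \<Sum>p\<in>A. \<Sum>q\<in>A. c p * c q * K p q ^ k) \<longlonglongrightarrow>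
      (\<Sum>p\<in>A. \<Sum>q\<in>A. c p * c q * (if p = q then 1 else 0))"
  proof (intro tendsto_sum tendsto_mult tendsto_const)
    fix p q assume "p \<in> A" "q \<in> A"
    then show "(\<lambda>k. K p q ^ k) \<longlonglongrightarrow> (if p = q then 1 else 0)"
      using one less by (auto intro: LIMSEQ_power_zero)
  qed
  also have "(\<Sum>p\<in>A. \<Sum>q\<in>A. c p * c q * (if p = q then 1 else 0)) = (\<Sum>p\<in>A. (c p)\<^sup>2)"
    using \<open>finite A\<close> by (simp add: power2_eq_square if_distrib cong: if_cong)
  finally show ?thesis .
qed

text \<open>The quadratic form is the series of the nonnegative terms \<open>a k * Q k\<close>.
  Since \<open>Q\<close> tends to the sum of the squares of the \<open>c i\<close>, it is eventually
  positive, and some positive \<open>a k\<close> occurs that late.\<close>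

lemma strictly_positive_definite_isotropic_kernel:
  fixes f :: "real \<Rightarrow> real" and a :: "nat \<Rightarrow> real"
  assumes a: "\<And>k. a k \<ge> 0" and inf: "infinite {k. a k > 0}"
    and f: "\<And>t. t \<in> {-1..1} \<Longrightarrow> (\<lambda>k. a k * ((1 + t) / 2) ^ k) sums f t"
  shows "strictly_positive_definite_kernel
    (proj_space n :: (nat \<Rightarrow> 'a::{real_normed_div_algebra,euclidean_space}) set set)
    (isotropic_kernel n f)"
proof -
  have main: "(\<Sum>i=1..N. \<Sum>j=1..N. c i * c j * isotropic_kernel n f (x i) (x j)) \<ge> 0 \<and>
    ((\<exists>i\<in>{1..N}. c i \<noteq> 0) \<longrightarrow>
      (\<Sum>i=1..N. \<Sum>j=1..N. c i * c j * isotropic_kernel n f (x i) (x j)) > 0)"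
    (is "?S \<ge> 0 \<and> _")
    if x: "x ` {1..N} \<subseteq> (proj_space n :: (nat \<Rightarrow> 'a) set set)" and inj: "inj_on x {1..N}"
    for N c and x :: "nat \<Rightarrow> (nat \<Rightarrow> 'a) set"
  proof -
    have "\<exists>u. x i = proj_line u \<and> proj_inner n u u = 1 \<and> u \<in> proj_vectors n" if "i \<in> {1..N}" for i
      using x that by (meson image_subset_iff proj_space_unit_span)
    then obtain u where u: "\<And>i. i \<in> {1..N} \<Longrightarrow> x i = proj_line (u i)"
      "\<And>i. i \<in> {1..N} \<Longrightarrow> proj_inner n (u i) (u i) = 1"
      "\<And>i. i \<in> {1..N} \<Longrightarrow> u i \<in> proj_vectors n"
      by metis
    define K where "K i j = (norm (hermitian n (u i) (u j)))\<^sup>2" for i j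
    define Q where "Q k = (\<Sum>i=1..N. \<Sum>j=1..N. c i * c j * K i j ^ k)" for k
    have K_less: "K i j < 1" if "i \<in> {1..N}" "j \<in> {1..N}" "i \<noteq> j" for i j
    proof -
      have "proj_line (u i) \<noteq> proj_line (u j)" using inj that u(1) by (metis inj_onD)
      then have "norm (hermitian n (u i) (u j)) < 1"
        using norm_hermitian_less_one u(2,3) that by blast
      then show ?thesis by (simp add: K_def abs_square_less_1)
    qed
    have K_one: "K i i = 1" if "i \<in> {1..N}" for i
    proof -
      have "hermitian n (u i) (u i) = 1"
      proof -
        have "conjugate y * y = inner y y *\<^sub>R 1" for y :: 'a
        proof -
          \<comment> \<open>Testing against every \<open>z\<close> allows the adjoint formula to
            evaluate the product.\<close>
          have "inner z (conjugate y * y) = inner z (inner y y *\<^sub>R 1)" for z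
            using inner_mult_left_adjoint[of y z y] inner_mult_mult_left[of y z 1] by simp
          then show ?thesis by (rule vector_eq_ldot[THEN iffD1, OF allI])
        qed
        then show ?thesis using u(2)[OF that]
          by (simp add: hermitian_def proj_inner_def scaleR_left.sum[symmetric])
      qed
      then show ?thesis by (simp add: K_def)
    qed
    have Q: "Q k \<ge> 0" for k
      unfolding Q_def K_def by (rule hermitian_power_nonneg)
    have "(\<lambda>k. a k * K i j ^ k) sums isotropic_kernel n f (x i) (x j)"
      if "i \<in> {1..N}" "j \<in> {1..N}" for i j
    proof -
      have "norm (hermitian n (u i) (u j)) \<le> 1"
        using u that by (intro norm_hermitian_le_one) auto
      then have "0 \<le> K i j" "K i j \<le> 1"
        by (auto simp: K_def power_le_one)
      then show ?thesis
        \<comment> \<open>At this argument \<open>(1 + t) / 2\<close> is exactly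
          \<open>K i j\<close>.\<close>
        using f[of "2 * K i j - 1"] u that by (simp add: isotropic_kernel_hermitian K_def)
    qed
    then have "(\<lambda>k. \<Sum>i=1..N. \<Sum>j=1..N. c i * c j * (a k * K i j ^ k)) sums ?S"
      by (intro sums_sum sums_mult) auto
    then have S: "(\<lambda>k. a k * Q k) sums ?S"
      by (simp add: Q_def sum_distrib_left mult_ac)
    have nonneg: "a k * Q k \<ge> 0" for k using a Q by simp
    moreover have "?S > 0" if i: "i \<in> {1..N}" "c i \<noteq> 0" for i
    proof -
      have "Q \<longlonglongrightarrow> (\<Sum>i=1..N. (c i)\<^sup>2)"
        unfolding Q_def using K_one K_less
        by (intro gram_power_tendsto) (auto simp: K_def)
      moreover have "(\<Sum>i=1..N. (c i)\<^sup>2) > 0"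
        using i by (intro sum_pos2[of _ i]) auto
      ultimately have "eventually (\<lambda>k. Q k > 0) sequentially"
        by (rule order_tendstoD)
      then obtain k0 where "\<And>k. k \<ge> k0 \<Longrightarrow> Q k > 0"
        by (auto simp: eventually_sequentially)
      moreover obtain k where "k \<ge> k0" "a k > 0"
        using inf by (auto simp: infinite_nat_iff_unbounded_le)
      ultimately have "a k * Q k > 0" by simp
      then show ?thesis
        using suminf_pos2[of "\<lambda>k. a k * Q k" k] S nonneg by (simp add: sums_iff)
    qed
    ultimately show ?thesis
      using sums_le[OF _ sums_zero S] by auto
  qed
  then show ?thesis
    unfolding strictly_positive_definite_kernel_def positive_definite_kernel_def by blast
qed

lemma spd_P_infinity_if_infinite_coefficients:
  assumes "continuous_on {-1..1} f"
    and "\<And>k. a k \<ge> 0" and "infinite {k. a k > 0}"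
    and "\<And>t. t \<in> {-1..1} \<Longrightarrow> (\<lambda>k. a k * ((1 + t) / 2) ^ k) sums f t"
  shows "spd_P_infinity f"
  unfolding spd_P_infinity_def
  by (intro conjI allI impI strictly_positive_definite_isotropic_kernel[OF assms(2,3)] assms(1,4))

section \<open>Polynomials\<close>

text \<open>Gaussian elimination, by induction on the set of equations: either equation
  \<open>b\<close> is trivial, or it is solved for one unknown \<open>q\<close>.\<close>

lemma nontrivial_solution_homogeneous_system:
  fixes \<phi> :: "'m \<Rightarrow> 'p \<Rightarrow> real"
  assumes "finite B" "finite A" "card B < card A"
  shows "\<exists>c. (\<exists>p\<in>A. c p \<noteq> 0) \<and> (\<forall>m\<in>B. (\<Sum>p\<in>A. c p * \<phi> m p) = 0)"
  using assms
proof (induction B arbitrary: A \<phi>)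
  case empty
  then have "A \<noteq> {}" by auto
  then show ?case by (intro exI[of _ "\<lambda>_. 1"]) auto
next
  case (insert b B)
  show ?case
  proof (cases "\<forall>p\<in>A. \<phi> b p = 0")
    case True
    from insert.prems insert.hyps have "card B < card A" by simp
    from insert.IH[OF insert.prems(1) this, of \<phi>] True show ?thesis by auto
  next
    case False
    then obtain q where q: "q \<in> A" "\<phi> b q \<noteq> 0" by auto
    \<comment> \<open>Row \<open>m\<close> minus the multiple of row \<open>b\<close> that clears
      column \<open>q\<close>.\<close>
    define \<psi> where "\<psi> m p = \<phi> m p - \<phi> m q * \<phi> b p / \<phi> b q" for m p
    have "card B < card (A - {q})" using insert.prems insert.hyps q by simp
    with insert.IH[of "A - {q}" \<psi>] insert.prems obtain c p
      where p: "p \<in> A - {q}" "c p \<noteq> 0" and c: "\<forall>m\<in>B. (\<Sum>p\<in>A - {q}. c p * \<psi> m p) = 0"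
      by auto
    \<comment> \<open>Equation \<open>b\<close> forces the value \<open>- s\<close> on the
      eliminated unknown \<open>q\<close>.\<close>
    define s where "s = (\<Sum>p\<in>A - {q}. c p * \<phi> b p) / \<phi> b q"
    define e where "e = c(q := - s)"
    have e: "(\<Sum>p\<in>A. e p * \<phi> m p) = (\<Sum>p\<in>A - {q}. c p * \<phi> m p) - s * \<phi> m q" for m
    proof -
      have "(\<Sum>p\<in>A. e p * \<phi> m p) = e q * \<phi> m q + (\<Sum>p\<in>A - {q}. e p * \<phi> m p)"
        using q insert.prems by (intro sum.remove) auto
      also have "(\<Sum>p\<in>A - {q}. e p * \<phi> m p) = (\<Sum>p\<in>A - {q}. c p * \<phi> m p)"
        by (intro sum.cong) (auto simp: e_def)
      finally show ?thesis by (simp add: e_def)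
    qed
    have "(\<Sum>p\<in>A. e p * \<phi> m p) = 0" if "m \<in> insert b B" for m
    proof (cases "m = b")
      case True
      then show ?thesis using q by (simp add: e s_def)
    next
      case False
      have "s * \<phi> m q = (\<Sum>p\<in>A - {q}. c p * (\<phi> m q * \<phi> b p / \<phi> b q))"
        unfolding s_def sum_divide_distrib sum_distrib_right
        by (intro sum.cong refl) simp
      then have "(\<Sum>p\<in>A. e p * \<phi> m p) = (\<Sum>p\<in>A - {q}. c p * \<psi> m p)"
        by (simp add: e \<psi>_def right_diff_distrib sum_subtractf)
      then show ?thesis using c that False by simp
    qed
    moreover have "\<exists>p\<in>A. e p \<noteq> 0" using p by (auto simp: e_def)
    ultimately show ?thesis by blast
  qed
qed

text \<open>With more points than features, some nonzero \<open>c\<close> annihilates every feature,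
  and the quadratic form vanishes at \<open>c\<close>.\<close>

lemma polynomial_not_spd_P_infinity:
  assumes "polynomial_on_Icc f"
  shows "\<not> spd_P_infinity f"
proof
  assume "spd_P_infinity f"
  then have spd: "strictly_positive_definite_kernel
      (proj_space 2 :: (nat \<Rightarrow> real) set set) (isotropic_kernel 2 f)"
    by (simp add: spd_P_infinity_def)
  obtain P where P: "\<And>t. t \<in> {-1..1} \<Longrightarrow> f t = poly P t"
    using assms by (auto simp: polynomial_on_Icc_def)
  \<comment> \<open>Substituting \<open>2 y - 1\<close> for \<open>t\<close> makes the kernel the
    polynomial \<open>R\<close> in the squared Hermitian product.\<close>
  define R where "R = pcompose P [:-1, 2:]"
  define D where "D = degree R"
  \<comment> \<open>Indexes the monomials in the binomial expansions of the even powers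
    \<open>?h ^ (2 * k)\<close>; \<open>j\<close> never exceeds \<open>2 * k\<close>, so the
    subtraction in the features is not truncated.\<close>
  define B where "B = (SIGMA k:{..D}. {..2 * k})"
  define N where "N = Suc (card B)"
  \<comment> \<open>Normalizes the vector \<open>(1, p, 0)\<close>. Different slopes
    \<open>p\<close> span different lines.\<close>
  define s where "s p = 1 / sqrt (1 + (real p)\<^sup>2)" for p
  define u :: "nat \<Rightarrow> nat \<Rightarrow> real" where
    "u p i = (if i = 0 then s p else if i = 1 then real p * s p else 0)" for p i
  define \<phi> where "\<phi> = (\<lambda>(k, j) p. u p 0 ^ j * u p 1 ^ (2 * k - j))"
  have "card B < card {1..N}" by (simp add: N_def)
  then obtain c where c: "\<exists>p\<in>{1..N}. c p \<noteq> 0"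
    and c0: "\<And>m. m \<in> B \<Longrightarrow> (\<Sum>p=1..N. c p * \<phi> m p) = 0"
    using nontrivial_solution_homogeneous_system[of B "{1..N}" \<phi>] by (auto simp: B_def)
  have s: "s p > 0" "(s p)\<^sup>2 * (1 + (real p)\<^sup>2) = 1" for p
    by (auto simp: s_def power_divide real_sqrt_pow2 add_pos_nonneg)
      (smt (verit) divide_self power2_less_0 nonzero_divide_eq_eq)
  have upto2: "{..2::nat} = {0, 1, 2}" by auto
  have unit: "proj_inner 2 (u p) (u p) = 1" for p
    using s(2)[of p] by (simp add: proj_inner_def upto2 u_def algebra_simps power2_eq_square)
  have herm: "(hermitian 2 (u p) (u q)) = u p 0 * u q 0 + u p 1 * u q 1" for p q
    by (simp add: hermitian_def upto2 conjugate_def u_def)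
  define x where "x p = proj_line (u p)" for p
  have "u p \<noteq> (\<lambda>_. 0)" for p
    using s(1)[of p] by (metis less_irrefl u_def)
  then have "x ` {1..N} \<subseteq> proj_space 2"
    by (auto simp: x_def proj_space_def proj_vectors_def u_def)
  moreover have "inj_on x {1..N}"
  proof (rule inj_onI)
    fix p q assume "x p = x q"
    moreover have "u p \<in> x p" by (auto simp: x_def proj_line_def intro!: range_eqI[of _ _ 1])
    ultimately obtain b where b: "u p = (\<lambda>i. u q i * b)" by (auto simp: x_def proj_line_def)
    from fun_cong[OF b, of 0] fun_cong[OF b, of 1] have "s p = s q * b" "p * s p = q * s q * b"
      by (simp_all add: u_def)
    then show "p = q" using s(1)[of p] s(1)[of q] by (cases "b = 0") auto
  qed
  moreover have "N \<ge> 1" by (simp add: N_def)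
  ultimately have "(\<Sum>p=1..N. \<Sum>q=1..N. c p * c q * isotropic_kernel 2 f (x p) (x q)) > 0"
    using spd c unfolding strictly_positive_definite_kernel_def by blast
  also have "(\<Sum>p=1..N. \<Sum>q=1..N. c p * c q * isotropic_kernel 2 f (x p) (x q)) =
      (\<Sum>p=1..N. \<Sum>q=1..N. \<Sum>k\<le>D. \<Sum>j\<le>2 * k. coeff R k * of_nat (2 * k choose j) *
        ((c p * \<phi> (k, j) p) * (c q * \<phi> (k, j) q)))"
  proof (intro sum.cong refl)
    fix p q
    let ?h = "hermitian 2 (u p) (u q)"
    have "norm ?h \<le> 1" by (intro norm_hermitian_le_one unit)
    then have "0 \<le> ?h\<^sup>2" "?h\<^sup>2 \<le> 1" by (auto simp: abs_square_le_1)
    then have "isotropic_kernel 2 f (x p) (x q) = poly P (2 * ?h\<^sup>2 - 1)"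
      unfolding x_def by (subst isotropic_kernel_hermitian[OF unit unit]) (auto intro!: P)
    also have "\<dots> = poly R (?h\<^sup>2)"
      by (simp add: R_def poly_pcompose algebra_simps)
    also have "\<dots> = (\<Sum>k\<le>D. coeff R k * ?h ^ (2 * k))"
      by (simp add: poly_altdef D_def power_mult)
    also have "\<dots> = (\<Sum>k\<le>D. \<Sum>j\<le>2 * k. coeff R k * of_nat (2 * k choose j) *
        (\<phi> (k, j) p * \<phi> (k, j) q))"
      by (simp add: herm binomial_ring sum_distrib_left \<phi>_def power_mult_distrib mult_ac)
    finally show "c p * c q * isotropic_kernel 2 f (x p) (x q) =
        (\<Sum>k\<le>D. \<Sum>j\<le>2 * k. coeff R k * of_nat (2 * k choose j) *
        ((c p * \<phi> (k, j) p) * (c q * \<phi> (k, j) q)))"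
      by (simp add: sum_distrib_left mult_ac)
  qed
  \<comment> \<open>Each summand factors into a coefficient times the square of a feature sum, and
    \<open>c\<close> makes all these sums zero.\<close>
  also have "\<dots> = (\<Sum>k\<le>D. \<Sum>j\<le>2 * k. coeff R k * of_nat (2 * k choose j) *
      ((\<Sum>p=1..N. c p * \<phi> (k, j) p) * (\<Sum>q=1..N. c q * \<phi> (k, j) q)))"
    unfolding sum_product
    by (simp only: sum_distrib_left sum.swap[of _ "{..m}" "{1..N}" for m])
  also have "\<dots> = 0"
    by (intro sum.neutral ballI) (use c0 in \<open>simp add: B_def\<close>)
  finally show False by simp
qed

text \<open>Otherwise nonnegativity makes all but finitely many coefficients zero, and the series is
  a polynomial.\<close>

lemma infinite_coefficients_if_not_polynomial:
  assumes "\<not> polynomial_on_Icc f" and a: "\<And>k. (a k :: real) \<ge> 0"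
    and f: "\<And>t. t \<in> {-1..1} \<Longrightarrow> (\<lambda>k. a k * ((1 + t) / 2) ^ k) sums f t"
  shows "infinite {k. a k > 0}"
proof
  assume fin: "finite {k. a k > 0}"
  have "f t = poly (\<Sum>k | a k > 0. smult (a k) ([:1/2, 1/2:] ^ k)) t" if "t \<in> {-1..1}" for t
  proof -
    have "(\<lambda>k. a k * ((1 + t) / 2) ^ k) sums (\<Sum>k | a k > 0. a k * ((1 + t) / 2) ^ k)"
      using fin by (intro sums_finite) (use a in \<open>auto simp: order_less_le\<close>)
    with f[OF that] have "f t = (\<Sum>k | a k > 0. a k * ((1 + t) / 2) ^ k)"
      by (rule sums_unique2)
    then show ?thesis by (simp add: poly_sum poly_power add_divide_distrib)
  qed
  with assms(1) show False by (auto simp: polynomial_on_Icc_def)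
qed

lemma spd_P_infinity_iff_not_polynomial:
  assumes "pd_P_infinity f"
  shows "spd_P_infinity f \<longleftrightarrow> \<not> polynomial_on_Icc f"
proof
  assume np: "\<not> polynomial_on_Icc f"
  obtain a where a: "\<And>k. a k \<ge> 0"
    "\<And>t. t \<in> {-1..1} \<Longrightarrow> (\<lambda>k. a k * ((1 + t) / 2) ^ k) sums f t"
    using assms unfolding pd_P_infinity_def by blast
  show "spd_P_infinity f"
    using assms infinite_coefficients_if_not_polynomial[OF np a] a
    by (intro spd_P_infinity_if_infinite_coefficients[of f a]) (auto simp: pd_P_infinity_def)
qed (use polynomial_not_spd_P_infinity in blast)

section \<open>Products\<close>

lemma polynomial_on_Icc_mult:
  assumes "polynomial_on_Icc f" "polynomial_on_Icc g"
  shows "polynomial_on_Icc (\<lambda>t. f t * g t)"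
  using assms unfolding polynomial_on_Icc_def by (metis poly_mult)

lemma spd_P_infinity_mult:
  assumes f: "pd_P_infinity f" and g: "pd_P_infinity g"
    and nz: "\<exists>t\<in>{-1..1}. g t \<noteq> 0" and np: "\<not> polynomial_on_Icc f"
  shows "spd_P_infinity (\<lambda>t. f t * g t)"
proof -
  obtain a where a: "\<And>k. a k \<ge> 0"
    "\<And>t. t \<in> {-1..1} \<Longrightarrow> (\<lambda>k. a k * ((1 + t) / 2) ^ k) sums f t"
    using f unfolding pd_P_infinity_def by blast
  obtain b where b: "\<And>k. b k \<ge> 0"
    "\<And>t. t \<in> {-1..1} \<Longrightarrow> (\<lambda>k. b k * ((1 + t) / 2) ^ k) sums g t"
    using g unfolding pd_P_infinity_def by blast
  have inf: "infinite {k. a k > 0}"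
    by (rule infinite_coefficients_if_not_polynomial[OF np a])
  obtain m where m: "b m > 0"
  \<comment> \<open>If no \<open>b m\<close> were positive, all would be zero and \<open>g\<close>
    would vanish on the interval.\<close>
  proof (rule ccontr)
    assume "\<not> thesis"
    then have "b k = 0" for k using b(1)[of k] that[of k] by (auto simp: order_less_le)
    then have "g t = 0" if "t \<in> {-1..1}" for t
      using b(2)[OF that] by (simp add: sums_iff)
    with nz show False by auto
  qed
  define d where "d k = (\<Sum>i\<le>k. a i * b (k - i))" for k
  show ?thesis
  proof (rule spd_P_infinity_if_infinite_coefficients[of _ d])
    show "continuous_on {-1..1} (\<lambda>t. f t * g t)"
      using f g by (auto simp: pd_P_infinity_def intro: continuous_intros)
    show "d k \<ge> 0" for k by (simp add: d_def sum_nonneg a b)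
    \<comment> \<open>The summand with index \<open>k\<close> is \<open>a k * b m\<close>, so a
      shift by \<open>m\<close> carries the positive indices of \<open>a\<close> to positive indices
      of \<open>d\<close>.\<close>
    have "d (k + m) > 0" if "a k > 0" for k
      unfolding d_def by (rule sum_pos2[of _ k]) (use that m a b in auto)
    then have "(\<lambda>k. k + m) ` {k. a k > 0} \<subseteq> {k. d k > 0}" by auto
    moreover have "infinite ((\<lambda>k. k + m) ` {k. a k > 0})"
      using inf by (simp add: finite_image_iff)
    ultimately show "infinite {k. d k > 0}" using finite_subset by blast
    fix t :: real assume t: "t \<in> {-1..1}"
    let ?y = "(1 + t) / 2"
    \<comment> \<open>On the interval \<open>?y\<close> is nonnegative, so both series converge
      absolutely, as the Cauchy product requires.\<close>
    have "summable (\<lambda>k. norm (a k * ?y ^ k))" "summable (\<lambda>k. norm (b k * ?y ^ k))"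
      using a b t by (auto simp: abs_mult sums_iff)
    from Cauchy_product_sums[OF this]
    have "(\<lambda>k. \<Sum>i\<le>k. a i * ?y ^ i * (b (k - i) * ?y ^ (k - i))) sums (f t * g t)"
      using a(2)[OF t] b(2)[OF t] by (simp add: sums_iff)
    moreover have "(\<Sum>i\<le>k. a i * ?y ^ i * (b (k - i) * ?y ^ (k - i))) = d k * ?y ^ k" for k
      unfolding d_def sum_distrib_right
    proof (intro sum.cong refl)
      fix i assume "i \<in> {..k}"
      then have "?y ^ k = ?y ^ i * ?y ^ (k - i)" by (simp flip: power_add)
      then show "a i * ?y ^ i * (b (k - i) * ?y ^ (k - i)) = a i * b (k - i) * ?y ^ k"
        by (simp only: mult_ac)
    qed
    ultimately show "(\<lambda>k. d k * ?y ^ k) sums (f t * g t)" by simp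
  qed
qed

theorem theorem3p3:
  fixes f g :: "real \<Rightarrow> real"
  assumes "continuous_on {-1..1} f" and "continuous_on {-1..1} g"
    and "\<exists>t\<in>{-1..1}. f t \<noteq> 0" and "\<exists>t\<in>{-1..1}. g t \<noteq> 0"
    and "pd_P_infinity f" and "pd_P_infinity g"
  shows "(spd_P_infinity (\<lambda>t. f t * g t) \<longleftrightarrow> spd_P_infinity f \<or> spd_P_infinity g) \<and>
    (spd_P_infinity f \<or> spd_P_infinity g \<longleftrightarrow> \<not> polynomial_on_Icc f \<or> \<not> polynomial_on_Icc g)"
proof -
  \<comment> \<open>(iii) implies (i); commutativity covers the case where \<open>g\<close> is the
    non-polynomial factor.\<close>
  have "spd_P_infinity (\<lambda>t. f t * g t)" if "\<not> polynomial_on_Icc f \<or> \<not> polynomial_on_Icc g"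
    using that spd_P_infinity_mult[of f g] spd_P_infinity_mult[of g f] assms
    by (auto simp: mult.commute)
  \<comment> \<open>(i) implies (iii) because a product of polynomials is a polynomial; (ii) and
    (iii) are equivalent factor by factor.\<close>
  then show ?thesis
    using polynomial_on_Icc_mult polynomial_not_spd_P_infinity
      spd_P_infinity_iff_not_polynomial assms(5,6) by blast
qed

end
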